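(* Let $|\alpha|<\pi/2$, $0\le\beta<1$, $m\ge1$ and $0\le q<1$. Let $\tau\in\mathbb{C}\setminus\{0\}$ and $-1\le B<A\le1$. If $f\in\mathcal{R}^\tau(A,B)$, then $\mathcal{I}_q^mf\in\mathcal{UCT}_p(\alpha,\beta)$ if $$(A-B)|\tau|\left(\frac{2qm}{1-q}+(2-\cos\alpha-\beta)\left[1-(1-q)^m\right]\right)\le\cos\alpha-\beta.$$
   Context: $\mathbb{U}=\{z\in\mathbb{C}:|z|<1\}$. $\mathcal{A}$ is the class of functions $f(z)=z+\sum_{n=2}^\infty a_nz^n$ analytic in $\mathbb{U}$ (so $f(0)=0$, $f'(0)=1$). $\mathcal{T}$ is the subclass of $\mathcal{A}$ of functions of the form $f(z)=z-\sum_{n=2}^\infty|a_n|z^n$, $z\in\mathbb{U}$. For $|\alpha|<\pi/2$ and $0\le\beta<1$, $\mathcal{SP}_p(\alpha,\beta)$ is the class of $f\in\mathcal{A}$ such that for all $z\in\mathbb{U}$ $$\operatorname{Re}\left\{e^{-i\alpha}\frac{zf'(z)}{f(z)}\right\}>\left|\frac{zf'(z)}{f(z)}-1\right|+\beta$$ (the quotient $zf'(z)/f(z)$ being read as $1$ at $z=0$). A function $f\in\mathcal{A}$ is in $\mathcal{UCV}_p(\alpha,\beta)$ if and only if the function $zf'(z)$ is in $\mathcal{SP}_p(\alpha,\beta)$. $\mathcal{UCT}_p(\alpha,\beta)=\mathcal{UCV}_p(\alpha,\beta)\cap\mathcal{T}$. For $\tau\in\mathbb{C}\setminus\{0\}$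 and $-1\le B<A\le1$, $\mathcal{R}^\tau(A,B)$ is the class of $f\in\mathcal{A}$ with $$\left|\frac{f'(z)-1}{(A-B)\tau-B[f'(z)-1]}\right|<1,\quad z\in\mathbb{U}.$$ For $f(z)=z+\sum_{n=2}^\infty a_nz^n\in\mathcal{A}$, the linear operator $\mathcal{I}_q^m:\mathcal{A}\to\mathcal{A}$ is $$\mathcal{I}_q^mf(z)=z+\sum_{n=2}^\infty\binom{n+m-2}{m-1}q^{n-1}(1-q)^ma_nz^n,\quad z\in\mathbb{U},$$ where $\binom{n+m-2}{m-1}=\frac{m(m+1)\cdots(m+n-2)}{(n-1)!}$.
   Formalization: As printed the claim fails: f=z+z²/4 gives an image with a positive coefficient, not in T; and cos α=β, q=0 fails. Proved instead, assuming β<cos α: the image is in UCV_p(α,β) for every f in R^τ(A,B), and in UCT_p(α,β) if also f is in T. *)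

theory Defs
  imports "HOL-Complex_Analysis.Complex_Analysis"
begin

text \<open>Functions on the unit disk are total functions on the complex plane. Every class below
  depends only on their values on \<^term>\<open>ball (0::complex) 1\<close>.\<close>

definition class_A :: "(complex \<Rightarrow> complex) set" where
  "class_A = {f. f holomorphic_on ball 0 1 \<and> f 0 = 0 \<and> deriv f 0 = 1}"

definition taylor_coeff :: "(complex \<Rightarrow> complex) \<Rightarrow> nat \<Rightarrow> complex" where
  "taylor_coeff f n = (deriv ^^ n) f 0 / fact n"

definition class_T :: "(complex \<Rightarrow> complex) set" where
  "class_T = {f \<in> class_A. \<exists>a :: nat \<Rightarrow> complex. \<forall>z \<in> ball 0 1.
     (\<lambda>n. complex_of_real (cmod (a (n + 2))) * z ^ (n + 2)) sums (z - f z)}"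

definition zlogderiv :: "(complex \<Rightarrow> complex) \<Rightarrow> complex \<Rightarrow> complex" where
  "zlogderiv f z = (if z = 0 then 1 else z * deriv f z / f z)"

text \<open>At a point \<open>z \<noteq> 0\<close> with \<open>f z = 0\<close> the convention \<open>x / 0 = 0\<close> turns the inequality below
  into \<open>0 > 1 + \<beta>\<close>. For \<open>\<beta> \<ge> 0\<close> functions with such a zero are therefore excluded.\<close>

definition class_SP :: "real \<Rightarrow> real \<Rightarrow> (complex \<Rightarrow> complex) set" where
  "class_SP \<alpha> \<beta> = {f \<in> class_A. \<forall>z \<in> ball 0 1.
     Re (exp (- \<i> * complex_of_real \<alpha>) * zlogderiv f z) > cmod (zlogderiv f z - 1) + \<beta>}"

definition class_UCV :: "real \<Rightarrow> real \<Rightarrow> (complex \<Rightarrow> complex) set" where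
  "class_UCV \<alpha> \<beta> = {f \<in> class_A. (\<lambda>z. z * deriv f z) \<in> class_SP \<alpha> \<beta>}"

definition class_UCT :: "real \<Rightarrow> real \<Rightarrow> (complex \<Rightarrow> complex) set" where
  "class_UCT \<alpha> \<beta> = class_UCV \<alpha> \<beta> \<inter> class_T"

text \<open>The denominator is required to be nonzero, since otherwise \<open>x / 0 = 0\<close> would make the
  inequality hold vacuously at its zeros.\<close>

definition class_R :: "complex \<Rightarrow> real \<Rightarrow> real \<Rightarrow> (complex \<Rightarrow> complex) set" where
  "class_R \<tau> A B = {f \<in> class_A. \<forall>z \<in> ball 0 1.
     complex_of_real (A - B) * \<tau> - complex_of_real B * (deriv f z - 1) \<noteq> 0 \<and>
     cmod ((deriv f z - 1) /
       (complex_of_real (A - B) * \<tau> - complex_of_real B * (deriv f z - 1))) < 1}"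

text \<open>\<open>pascal_binom m n\<close> is \<open>m (m + 1) \<dots> (m + n - 2) / (n - 1)!\<close>, a product of \<open>n - 1\<close> factors
  for \<open>n \<ge> 1\<close>. For a positive integer \<open>m\<close> it is the binomial coefficient of \<open>n + m - 2\<close> over
  \<open>m - 1\<close>.\<close>

definition pascal_binom :: "real \<Rightarrow> nat \<Rightarrow> real" where
  "pascal_binom m n = pochhammer m (n - 1) / fact (n - 1)"

definition pascal_op :: "real \<Rightarrow> real \<Rightarrow> (complex \<Rightarrow> complex) \<Rightarrow> complex \<Rightarrow> complex" where
  "pascal_op q m f z = z + (\<Sum>k. complex_of_real
     (pascal_binom m (k + 2) * q ^ (k + 1) * (1 - q) powr m) * taylor_coeff f (k + 2) * z ^ (k + 2))"

end

theory Submission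
  imports Defs
begin

text \<open>For \<open>f\<close> in \<open>R\<^sup>\<tau>(A, B)\<close>, the function \<open>g = f' - 1\<close> takes values in the set where
  \<open>|g| < |(A - B) \<tau> - B g|\<close>, which is convex because \<open>|B| \<le> 1\<close>. The average \<open>h\<close> of \<open>g\<close>
  over rotations by \<open>n\<close>-th roots of unity stays in this set and loses every Taylor coefficient whose
  index is not a multiple of \<open>n\<close>, so Cauchy's inequality for \<open>h / ((A - B) \<tau> - B h)\<close> at order
  \<open>n\<close> yields \<open>(n + 1) |a\<^bsub>n+1\<^esub>| \<le> (A - B) |\<tau>|\<close>.

  A normalized function \<open>F = z + \<Sum> b\<^sub>n z\<^sup>n\<close> lies in \<open>UCV\<^sub>p(\<alpha>, \<beta>)\<close> as soon as
  \<open>\<Sum> n (2 n - cos \<alpha> - \<beta>) |b\<^sub>n| \<le> cos \<alpha> - \<beta>\<close>: with \<open>w = z F'' / F'\<close> it suffices that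
  \<open>2 |w| < cos \<alpha> - \<beta>\<close>. For the Pascal operator the two bounds combine, and the resulting series
  is evaluated with the negative binomial series.\<close>

section \<open>Taylor coefficients and the normalized class\<close>

lemma taylor_coeff_sums:
  assumes "f holomorphic_on ball 0 1" "z \<in> ball 0 1"
  shows "(\<lambda>n. taylor_coeff f n * z ^ n) sums f z"
  using holomorphic_power_series[OF assms] by (simp add: taylor_coeff_def)

lemma taylor_coeff_eqI:
  assumes "\<And>z. z \<in> ball 0 1 \<Longrightarrow> (\<lambda>n. b n * z ^ n) sums f z"
  shows "taylor_coeff f n = b n"
proof -
  have "eventually (\<lambda>z. z \<in> ball (0::complex) 1) (nhds 0)"
    by (intro eventually_nhds_in_open) auto
  then have "f has_fps_expansion Abs_fps b"
    by (intro has_fps_expansionI) (auto elim!: eventually_mono simp: assms)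
  from fps_nth_fps_expansion[OF this, of n] show ?thesis
    by (simp add: taylor_coeff_def)
qed

lemma taylor_coeff_deriv: "taylor_coeff (deriv f) n = of_nat (n + 1) * taylor_coeff f (n + 1)"
proof -
  have "complex_of_nat (n + 1) \<noteq> 0" unfolding of_nat_eq_0_iff by simp
  then show ?thesis
    unfolding taylor_coeff_def by (simp add: funpow_Suc_right del: funpow.simps)
qed

lemma class_A_taylor_coeff:
  assumes "f \<in> class_A"
  shows "taylor_coeff f 0 = 0" "taylor_coeff f 1 = 1"
  using assms by (auto simp: class_A_def taylor_coeff_def)

lemma class_A_if_sums:
  assumes "\<And>z. z \<in> ball 0 1 \<Longrightarrow> (\<lambda>n. b n * z ^ n) sums f z" "b 0 = 0" "b 1 = 1"
  shows "f \<in> class_A"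
proof -
  have "f holomorphic_on ball 0 1"
    by (rule power_series_holomorphic[where a = b]) (use assms in auto)
  moreover have "f 0 = 0" "deriv f 0 = 1"
    using taylor_coeff_eqI[OF assms(1), of 0] taylor_coeff_eqI[OF assms(1), of 1] assms(2,3)
    by (auto simp: taylor_coeff_def)
  ultimately show ?thesis by (auto simp: class_A_def)
qed

lemma class_A_zderiv:
  assumes "f \<in> class_A"
  shows "(\<lambda>z. z * deriv f z) \<in> class_A"
proof -
  have hol: "deriv f holomorphic_on ball 0 1"
    using assms by (auto simp: class_A_def intro: holomorphic_deriv)
  then have "(deriv f has_field_derivative deriv (deriv f) 0) (at 0)"
    by (intro holomorphic_derivI[of _ "ball 0 1"]) auto
  then have "((\<lambda>z. z * deriv f z) has_field_derivative deriv f 0) (at 0)"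
    by (auto intro!: derivative_eq_intros)
  with hol assms show ?thesis
    by (auto simp: class_A_def intro!: holomorphic_intros dest: DERIV_imp_deriv)
qed

section \<open>Coefficient bounds by averaging over roots of unity\<close>

text \<open>Squaring both sides leaves a sublevel set of a multiple of |w|^2 plus a real-linear
  term, and the multiple \<open>1 - B\<^sup>2\<close> is nonnegative. For \<open>T\<close> nonzero
  the set is an open disc, or a half plane when |B| = 1.\<close>

lemma convex_norm_less_linear:
  assumes "\<bar>B::real\<bar> \<le> 1"
  shows "convex {w::complex. cmod w < cmod (T - of_real B * w)}"
proof -
  define Q where "Q w = (1 - B\<^sup>2) * (cmod w)\<^sup>2 + 2 * B * Re (cnj T * w)" for w
  have eq: "cmod w < cmod (T - of_real B * w) \<longleftrightarrow> Q w < (cmod T)\<^sup>2" for w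
  proof -
    have "cmod w < cmod (T - of_real B * w) \<longleftrightarrow> (cmod w)\<^sup>2 < (cmod (T - of_real B * w))\<^sup>2"
      by (metis abs_norm_cancel norm_ge_zero power2_less_imp_less power_strict_mono pos2)
    also have "(cmod (T - of_real B * w))\<^sup>2 = (cmod T)\<^sup>2 - 2 * B * Re (cnj T * w) + B\<^sup>2 * (cmod w)\<^sup>2"
      unfolding cmod_power2 by (simp add: power2_eq_square algebra_simps)
    finally show ?thesis by (auto simp: Q_def algebra_simps)
  qed
  show ?thesis
  proof (rule convexI, unfold mem_Collect_eq eq)
    fix x y :: complex and u v :: real
    assume *: "Q x < (cmod T)\<^sup>2" "Q y < (cmod T)\<^sup>2" "0 \<le> u" "0 \<le> v" "u + v = 1"
    have v: "v = 1 - u" using * by simp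
    \<comment> \<open>The linear part of \<open>Q\<close> is preserved by convex combinations. The
      defect comes from |ux + vy|^2 = u|x|^2 + v|y|^2 - uv|x - y|^2 for u + v = 1.\<close>
    have "Q (u *\<^sub>R x + v *\<^sub>R y) = u * Q x + v * Q y - u * v * (1 - B\<^sup>2) * (cmod (x - y))\<^sup>2"
      unfolding Q_def cmod_power2 v by (simp add: power2_eq_square algebra_simps)
    moreover have "0 \<le> u * v * (1 - B\<^sup>2) * (cmod (x - y))\<^sup>2"
      using * assms by (auto simp: abs_square_le_1)
    moreover have "u * Q x + v * Q y < (cmod T)\<^sup>2"
      using * by (intro convex_bound_lt) auto
    ultimately show "Q (u *\<^sub>R x + v *\<^sub>R y) < (cmod T)\<^sup>2" by linarith
  qed
qed

text \<open>Nothing is assumed on the unit circle, so Cauchy's inequality is applied on radius r < 1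
  and r then tends to 1 from the left.\<close>

lemma taylor_coeff_le_one_if_bounded:
  assumes "f holomorphic_on ball 0 1" "\<And>z. z \<in> ball 0 1 \<Longrightarrow> cmod (f z) \<le> 1"
  shows "cmod (taylor_coeff f n) \<le> 1"
proof -
  have "cmod ((deriv ^^ n) f 0) * r ^ n \<le> fact n" if "0 < r" "r < 1" for r
  proof -
    have "cmod ((deriv ^^ n) f 0) \<le> fact n * 1 / r ^ n"
    proof (rule Cauchy_inequality)
      show "f holomorphic_on ball 0 r"
        by (rule holomorphic_on_subset[OF assms(1)]) (use that in auto)
      show "continuous_on (cball 0 r) f"
        by (rule continuous_on_subset[OF holomorphic_on_imp_continuous_on[OF assms(1)]])
          (use that in auto)
    qed (use that assms in auto)
    with that show ?thesis by (simp add: field_simps)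
  qed
  then have "eventually (\<lambda>r. cmod ((deriv ^^ n) f 0) * r ^ n \<le> fact n) (at_left 1)"
    unfolding eventually_at_left_field by (intro exI[of _ 0]) auto
  moreover have "((\<lambda>r. cmod ((deriv ^^ n) f 0) * r ^ n) \<longlongrightarrow> cmod ((deriv ^^ n) f 0) * 1 ^ n) (at_left 1)"
    by (intro tendsto_intros)
  ultimately have "cmod ((deriv ^^ n) f 0) * 1 ^ n \<le> fact n"
    by (intro tendsto_upperbound) auto
  then show ?thesis by (simp add: taylor_coeff_def norm_divide)
qed

text \<open>Averaging multiplies the k-th coefficient by the mean of the k-th powers of all n-th
  roots of unity, which is 1 or 0 according to whether n divides k.\<close>

lemma taylor_coeff_average:
  fixes n :: nat and g :: "complex \<Rightarrow> complex"
  defines "\<zeta> \<equiv> exp (2 * of_real pi * \<i> / of_nat n)"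
  assumes "g holomorphic_on ball 0 1" "n > 0"
  shows "taylor_coeff (\<lambda>z. (\<Sum>j<n. g (\<zeta> ^ j * z)) / of_nat n) k
           = (if n dvd k then taylor_coeff g k else 0)"
proof -
  have \<zeta>: "cmod \<zeta> = 1" "\<zeta> ^ n = 1" "\<zeta> ^ k = 1 \<longleftrightarrow> n dvd k" for k
  proof -
    show "cmod \<zeta> = 1" by (simp add: \<zeta>_def)
    show *: "\<zeta> ^ k = 1 \<longleftrightarrow> n dvd k" for k
      using complex_root_unity_eq_1[of n k] assms(3)
      by (simp add: \<zeta>_def exp_of_nat_mult[symmetric] field_simps)
    show "\<zeta> ^ n = 1" using *[of n] by simp
  qed
  have avg: "(\<Sum>j<n. (\<zeta> ^ j) ^ k) / of_nat n = (if n dvd k then 1 else 0)" for k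
  proof (cases "n dvd k")
    case True
    then have "(\<zeta> ^ j) ^ k = 1" for j
      using \<zeta>(3)[of k] by (metis mult.commute power_mult power_one)
    then show ?thesis using True assms(3) by simp
  next
    case False
    \<comment> \<open>\<open>\<zeta> ^ k\<close> is an n-th root of unity other than 1, so its
      geometric sum vanishes.\<close>
    then have "\<zeta> ^ k \<noteq> 1" using \<zeta>(3) by simp
    then have "(\<Sum>j<n. (\<zeta> ^ k) ^ j) = 0"
      using geometric_sum[of "\<zeta> ^ k" n] \<zeta>(2)
      by (metis diff_self div_0 mult.commute power_mult power_one)
    moreover have "(\<zeta> ^ j) ^ k = (\<zeta> ^ k) ^ j" for j
      by (metis mult.commute power_mult)
    ultimately show ?thesis using False by simp
  qed
  have "(\<lambda>k. (if n dvd k then taylor_coeff g k else 0) * z ^ k) sums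
          ((\<Sum>j<n. g (\<zeta> ^ j * z)) / of_nat n)" if "z \<in> ball 0 1" for z
  proof -
    have "(\<lambda>k. (\<Sum>j<n. taylor_coeff g k * (\<zeta> ^ j * z) ^ k) / of_nat n) sums
            ((\<Sum>j<n. g (\<zeta> ^ j * z)) / of_nat n)"
      by (intro sums_divide sums_sum taylor_coeff_sums[OF assms(2)])
        (use that \<zeta>(1) in \<open>auto simp: norm_mult norm_power\<close>)
    also have "(\<lambda>k. (\<Sum>j<n. taylor_coeff g k * (\<zeta> ^ j * z) ^ k) / of_nat n)
             = (\<lambda>k. (\<Sum>j<n. (\<zeta> ^ j) ^ k) / of_nat n * (taylor_coeff g k * z ^ k))"
      by (simp add: power_mult_distrib sum_distrib_left sum_distrib_right
          sum_divide_distrib mult_ac)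
    finally show ?thesis unfolding avg by (rule sums_cong[THEN iffD1, rotated]) auto
  qed
  then show ?thesis by (rule taylor_coeff_eqI)
qed

text \<open>A case of Rogosinski's theorem: \<open>g\<close> is subordinate to T w / (1 + B w),
  which has convex image and derivative T at 0. The average \<open>h\<close> has the same n-th
  coefficient as \<open>g\<close> but none of orders 1 to n - 1, so no lower-order products disturb
  the comparison.\<close>

lemma taylor_coeff_subordinate:
  assumes hol: "g holomorphic_on ball 0 1" and "g 0 = 0" and "n > 0" and B: "\<bar>B::real\<bar> \<le> 1"
    and less: "\<And>z. z \<in> ball 0 1 \<Longrightarrow> cmod (g z) < cmod (T - of_real B * g z)"
  shows "cmod (taylor_coeff g n) \<le> cmod T"
proof -
  define \<zeta> where "\<zeta> = exp (2 * of_real pi * \<i> / of_nat n)"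
  define h where "h z = (\<Sum>j<n. g (\<zeta> ^ j * z)) / of_nat n" for z
  define w where "w z = h z / (T - of_real B * h z)" for z
  have \<zeta>: "cmod \<zeta> = 1" by (simp add: \<zeta>_def)
  have in_ball: "\<zeta> ^ j * z \<in> ball 0 1" if "z \<in> ball 0 1" for j z
    using that \<zeta> by (simp add: norm_mult norm_power)
  have h_coeff: "taylor_coeff h k = (if n dvd k then taylor_coeff g k else 0)" for k
    unfolding h_def \<zeta>_def by (rule taylor_coeff_average) fact+
  have h_less: "cmod (h z) < cmod (T - of_real B * h z)" if "z \<in> ball 0 1" for z
  proof -
    have "(\<Sum>j<n. (1 / real n) *\<^sub>R g (\<zeta> ^ j * z)) \<in> {w. cmod w < cmod (T - of_real B * w)}"
      by (rule convex_sum[OF _ convex_norm_less_linear[OF B]])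
        (use that in_ball less \<open>n > 0\<close> in auto)
    also have "(\<Sum>j<n. (1 / real n) *\<^sub>R g (\<zeta> ^ j * z)) = h z"
      by (simp add: h_def sum_divide_distrib scaleR_conv_of_real)
    finally show ?thesis by simp
  qed
  then have nz: "T - of_real B * h z \<noteq> 0" if "z \<in> ball 0 1" for z
    using that by fastforce
  have g_comp: "(\<lambda>z. g (\<zeta> ^ j * z)) holomorphic_on ball 0 1" for j
    by (rule holomorphic_on_compose_gen[OF _ hol, unfolded o_def])
      (use in_ball in \<open>auto intro!: holomorphic_intros\<close>)
  have h_hol: "h holomorphic_on ball 0 1"
    unfolding h_def by (intro holomorphic_intros g_comp) (use \<open>n > 0\<close> in auto)
  have w_hol: "w holomorphic_on ball 0 1"
    unfolding w_def by (intro holomorphic_intros h_hol nz)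
  have "cmod (w z) \<le> 1" if "z \<in> ball 0 1" for z
    using h_less[OF that] nz[OF that] by (simp add: w_def norm_divide divide_le_eq)
  then have w_bound: "cmod (taylor_coeff w n) \<le> 1"
    by (rule taylor_coeff_le_one_if_bounded[OF w_hol])
  have h0: "taylor_coeff h 0 = 0"
    using h_coeff[of 0] \<open>g 0 = 0\<close> by (simp add: taylor_coeff_def)
  then have w0: "taylor_coeff w 0 = 0"
    by (simp add: taylor_coeff_def w_def)
  have expand: "F has_fps_expansion fps_expansion F 0" if "F holomorphic_on ball 0 1" for F
    using that by (intro has_fps_expansion_fps_expansion) auto
  have nth: "fps_nth (fps_expansion F 0) k = taylor_coeff F k" for F k
    by (simp add: fps_expansion_def taylor_coeff_def)
  \<comment> \<open>The definition of \<open>w\<close> is cleared of its denominator, so that n-th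
    coefficients can be compared through a Cauchy product.\<close>
  have "(\<lambda>z. w z * (T - of_real B * h z)) has_fps_expansion
          fps_expansion w 0 * (fps_const T - fps_const (of_real B) * fps_expansion h 0)"
    by (intro fps_expansion_intros expand h_hol w_hol)
  moreover have "eventually (\<lambda>z. z \<in> ball (0::complex) 1) (nhds 0)"
    by (intro eventually_nhds_in_open) auto
  then have "eventually (\<lambda>z. w z * (T - of_real B * h z) = h z) (nhds 0)"
    by eventually_elim (use nz in \<open>simp add: w_def\<close>)
  ultimately have "h has_fps_expansion
          fps_expansion w 0 * (fps_const T - fps_const (of_real B) * fps_expansion h 0)"
    by (subst (asm) has_fps_expansion_cong) auto
  from fps_expansion_unique_complex[OF this expand[OF h_hol]]
  have "taylor_coeff h n = fps_nth (fps_expansion w 0 *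
          (fps_const T - fps_const (of_real B) * fps_expansion h 0)) n"
    by (simp flip: nth)
  also have "\<dots> = taylor_coeff w n * T -
      of_real B * (\<Sum>i\<le>n. taylor_coeff w i * taylor_coeff h (n - i))"
  proof -
    have "fps_expansion w 0 * (fps_const T - fps_const (of_real B) * fps_expansion h 0) =
        fps_const T * fps_expansion w 0 - fps_const (of_real B) * (fps_expansion w 0 * fps_expansion h 0)"
      by (simp only: right_diff_distrib mult_ac)
    then show ?thesis
      by (simp only: fps_sub_nth fps_mult_left_const_nth) (simp add: fps_mult_nth nth atLeast0AtMost)
  qed
  also have "(\<Sum>i\<le>n. taylor_coeff w i * taylor_coeff h (n - i)) = 0"
  proof (rule sum.neutral, safe)
    fix i assume "i \<le> n"
    show "taylor_coeff w i * taylor_coeff h (n - i) = 0"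
    \<comment> \<open>At both ends a constant term of \<open>w\<close> or \<open>h\<close> enters,
      and both are zero. Strictly between, 0 < n - i < n is not a multiple of n.\<close>
    proof (cases "i = 0 \<or> i = n")
      case True
      then show ?thesis using w0 h0 by auto
    next
      case False
      then have "\<not> n dvd n - i" using \<open>i \<le> n\<close> by (auto dest!: dvd_imp_le)
      then show ?thesis by (simp add: h_coeff)
    qed
  qed
  finally have "taylor_coeff g n = taylor_coeff w n * T"
    by (simp add: h_coeff)
  then show ?thesis
    using w_bound by (simp add: norm_mult mult_left_le_one_le)
qed

text \<open>The subordination bound is applied to f' - 1 with T = (A - B) \<tau>. Its coefficient of
  order n - 1 is n times the n-th coefficient of f, since n - 1 > 0 keeps the constant 1
  out.\<close>

lemma class_R_taylor_coeff_bound: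
  assumes "f \<in> class_R \<tau> A B" "-1 \<le> B" "B < A" "A \<le> 1" "n \<ge> 2"
  shows "of_nat n * cmod (taylor_coeff f n) \<le> (A - B) * cmod \<tau>"
proof -
  have f: "f \<in> class_A" using assms by (simp add: class_R_def)
  then have hol: "deriv f holomorphic_on ball 0 1"
    by (auto simp: class_A_def intro: holomorphic_deriv)
  have "cmod (taylor_coeff (\<lambda>z. deriv f z - 1) (n - 1)) \<le> cmod (of_real (A - B) * \<tau>)"
  proof (rule taylor_coeff_subordinate)
    show "(\<lambda>z. deriv f z - 1) holomorphic_on ball 0 1"
      by (intro holomorphic_intros hol)
    show "deriv f 0 - 1 = 0" using f by (simp add: class_A_def)
    show "cmod (deriv f z - 1) < cmod (of_real (A - B) * \<tau> - of_real B * (deriv f z - 1))"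
      if "z \<in> ball 0 1" for z
    proof -
      \<comment> \<open>The nonvanishing denominator in \<open>class_R\<close> is what permits
        passing from the quotient to the strict inequality.\<close>
      have "cmod x < cmod y" if "y \<noteq> 0" "cmod (x / y) < 1" for x y
        using that by (simp add: norm_divide)
      then show ?thesis using assms(1) that by (simp add: class_R_def)
    qed
  qed (use assms in auto)
  moreover have "taylor_coeff (\<lambda>z. deriv f z - 1) (n - 1) = taylor_coeff (deriv f) (n - 1)"
    using higher_deriv_diff[OF hol holomorphic_on_const[of 1], of 0 "n - 1"] assms(5)
    by (simp add: taylor_coeff_def)
  moreover have "\<dots> = of_nat n * taylor_coeff f n"
    using taylor_coeff_deriv[of f "n - 1"] assms(5) by (simp add: of_nat_diff)
  moreover have "cmod (of_real (A - B) * \<tau>) = (A - B) * cmod \<tau>"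
    using assms(3) by (simp only: norm_mult norm_of_real)
  ultimately show ?thesis by (simp only: norm_mult norm_of_nat)
qed

section \<open>A sufficient coefficient condition for membership in UCV\<close>

text \<open>With u = z f'' / f', the inequality to prove is Re (e^(-i \<alpha>) (1 + u)) > |u| +
  \<beta>. Rotation preserves |u|, so the left side is at least cos \<alpha> - |u|. Then |u| is
  bounded by estimating the series of z f'' and f' - 1 termwise.\<close>

lemma UCV_criterion:
  fixes f :: "complex \<Rightarrow> complex" and \<alpha> \<beta> :: real
  defines "t \<equiv> \<lambda>n. real (n + 2) * (2 * real (n + 2) - cos \<alpha> - \<beta>) * cmod (taylor_coeff f (n + 2))"
  assumes f: "f \<in> class_A" and "\<beta> < cos \<alpha>" and summ: "summable t" and le: "suminf t \<le> cos \<alpha> - \<beta>"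
  shows "f \<in> class_UCV \<alpha> \<beta>"
proof -
  \<comment> \<open>\<open>d n\<close> is the modulus of the coefficient of order n + 1 of f'. On
    the disc \<open>D\<close> will bound |f' - 1|, and \<open>N\<close> will bound |z f''|.\<close>
  define d where "d n = real (n + 2) * cmod (taylor_coeff f (n + 2))" for n
  define C where "C = cos \<alpha> - \<beta>"
  define D where "D = (\<Sum>n. d n)"
  define N where "N = (\<Sum>n. real (n + 1) * d n)"
  have cos: "cos \<alpha> \<le> 1" "\<beta> < 1" "\<beta> < cos \<alpha>"
    using \<open>\<beta> < cos \<alpha>\<close> cos_le_one[of \<alpha>] by linarith+
  have C: "C > 0" using cos by (simp add: C_def)
  have d: "d n \<ge> 0" for n by (simp add: d_def)
  have t: "t n = (2 * real (n + 1) + (2 - cos \<alpha> - \<beta>)) * d n" for n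
    by (simp add: t_def d_def algebra_simps)
  have summN: "summable (\<lambda>n. real (n + 1) * d n)"
  proof (rule summable_comparison_test'[OF summ, of 0])
    fix n
    have "real (n + 1) * d n \<le> t n"
    proof -
      have "0 < 2 - cos \<alpha> - \<beta>" using cos by linarith
      then have "real (n + 1) \<le> 2 * real (n + 1) + (2 - cos \<alpha> - \<beta>)" by simp
      then show ?thesis unfolding t by (rule mult_right_mono) (rule d)
    qed
    then show "norm (real (n + 1) * d n) \<le> t n" using d[of n] by simp
  qed
  have dN: "d n \<le> real (n + 1) * d n" for n
    using d[of n] by (simp add: algebra_simps)
  have summD: "summable d"
    by (rule summable_comparison_test'[OF summN, of 0]) (use d dN in simp)
  have D: "0 \<le> D" unfolding D_def by (intro suminf_nonneg summD d)
  have DN: "D \<le> N" unfolding D_def N_def by (intro suminf_le summD summN dN)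
  have "t = (\<lambda>n. 2 * (real (n + 1) * d n) + (2 - cos \<alpha> - \<beta>) * d n)"
    unfolding t by (simp only: distrib_right mult.assoc)
  moreover have "\<dots> sums (2 * N + (2 - cos \<alpha> - \<beta>) * D)"
    unfolding N_def D_def by (intro sums_add sums_mult summable_sums summN summD)
  ultimately have "suminf t = 2 * N + (2 - cos \<alpha> - \<beta>) * D"
    by (simp only: sums_unique[symmetric])
  \<comment> \<open>As cos \<alpha> is at most 1, the factor 2 - cos \<alpha> - \<beta> is at least
    \<open>C\<close>; the weaker factor suffices below.\<close>
  moreover have "C * D \<le> (2 - cos \<alpha> - \<beta>) * D"
    using D cos by (intro mult_right_mono) (auto simp: C_def)
  ultimately have key: "2 * N + C * D \<le> C" using le by (simp add: C_def)
  have D1: "D < 1"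
  proof (rule ccontr)
    assume "\<not> D < 1"
    \<comment> \<open>Together with \<open>key\<close> this would force N to be at most 0, whereas N
      is at least D and D at least 1.\<close>
    then have "C * 1 \<le> C * D" using C by (intro mult_left_mono) auto
    then show False using key DN \<open>\<not> D < 1\<close> by linarith
  qed
  have hol: "deriv f holomorphic_on ball 0 1"
    using f by (auto simp: class_A_def intro: holomorphic_deriv)
  then have hol2: "deriv (deriv f) holomorphic_on ball 0 1"
    by (rule holomorphic_deriv) auto
  have SP: "Re (exp (- \<i> * of_real \<alpha>) * zlogderiv (\<lambda>z. z * deriv f z) z)
          > cmod (zlogderiv (\<lambda>z. z * deriv f z) z - 1) + \<beta>" if z: "z \<in> ball 0 1" for z
  proof (cases "z = 0")
    case True
    then show ?thesis using cos by (simp add: zlogderiv_def Re_exp)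
  next
    case False
    define r where "r = cmod z"
    have r: "0 < r" "r < 1" using z False by (auto simp: r_def)
    \<comment> \<open>One factor r = |z| < 1 is retained: the hypothesis on \<open>suminf t\<close>
      is not strict, and r < 1 later supplies the strict inequality.\<close>
    have powr: "r ^ (n + 1) \<le> r" for n
      using r by (simp add: mult_left_le power_le_one)
    have bound: "cmod s \<le> r * suminf e"
      if s: "(\<lambda>n. c n * z ^ (n + 1)) sums s" and e: "summable e" and ce: "\<And>n. cmod (c n) = e n" for c e s
    proof -
      have le: "cmod (c n * z ^ (n + 1)) \<le> r * e n" for n
        using mult_left_mono[OF powr, of "e n" n] ce[of n] norm_ge_zero[of "c n"]
        by (simp add: norm_mult norm_power r_def mult_ac)
      have "summable (\<lambda>n. cmod (c n * z ^ (n + 1)))"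
        by (rule summable_comparison_test'[OF summable_mult[OF e, of r], of 0]) (use le in simp)
      then have "cmod s \<le> (\<Sum>n. cmod (c n * z ^ (n + 1)))"
        unfolding sums_unique[OF s] by (rule summable_norm)
      also have "\<dots> \<le> (\<Sum>n. r * e n)"
        by (intro suminf_le le summable_mult e) fact
      also have "\<dots> = r * suminf e" by (rule suminf_mult[OF e])
      finally show ?thesis .
    qed
    have "(\<lambda>n. taylor_coeff (deriv f) (n + 1) * z ^ (n + 1)) sums (deriv f z - 1)"
      using sums_split_initial_segment[OF taylor_coeff_sums[OF hol z], of 1] class_A_taylor_coeff[OF f]
      by (simp add: taylor_coeff_deriv)
    then have b1: "cmod (deriv f z - 1) \<le> r * D"
      unfolding D_def
      by (rule bound[OF _ summD]) (simp only: taylor_coeff_deriv d_def norm_mult norm_of_nat add.assoc one_add_one)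
    have "(\<lambda>n. z * (taylor_coeff (deriv (deriv f)) n * z ^ n)) sums (z * deriv (deriv f) z)"
      by (intro sums_mult taylor_coeff_sums hol2 z)
    then have "(\<lambda>n. taylor_coeff (deriv (deriv f)) n * z ^ (n + 1)) sums (z * deriv (deriv f) z)"
      by (simp add: mult_ac)
    then have b2: "cmod (z * deriv (deriv f) z) \<le> r * N"
      unfolding N_def
      by (rule bound[OF _ summN]) (simp only: taylor_coeff_deriv d_def norm_mult norm_of_nat add.assoc one_add_one)
    have rD: "r * D < 1" using r D D1 mult_left_le_one_le[of D r] by linarith
    have low: "1 - r * D \<le> cmod (deriv f z)"
      using norm_triangle_ineq2[of 1 "1 - deriv f z"] b1 by (simp add: norm_minus_commute)
    then have nz: "deriv f z \<noteq> 0" using rD by auto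
    define u where "u = z * deriv (deriv f) z / deriv f z"
    have "((\<lambda>z. z * deriv f z) has_field_derivative (deriv f z + z * deriv (deriv f) z)) (at z)"
      by (auto intro!: derivative_eq_intros holomorphic_derivI[OF hol] z)
    from DERIV_imp_deriv[OF this]
    have w: "zlogderiv (\<lambda>z. z * deriv f z) z = 1 + u"
      using False nz by (simp add: zlogderiv_def u_def field_simps)
    have "2 * r * N \<le> r * (C - C * D)"
      using mult_left_mono[of "2 * N" "C - C * D" r] key r by (simp add: mult_ac)
    also have "\<dots> < C * (1 - r * D)"
      using mult_strict_right_mono[of r 1 C] r C by (simp add: algebra_simps)
    also have "\<dots> \<le> C * cmod (deriv f z)"
      using low C by simp
    finally have "2 * cmod (z * deriv (deriv f) z) < C * cmod (deriv f z)" using b2 by linarith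
    then have u: "2 * cmod u < C"
      using nz by (simp add: u_def norm_divide divide_less_eq)
    have "\<bar>Re (exp (- \<i> * of_real \<alpha>) * u)\<bar> \<le> cmod (exp (- \<i> * of_real \<alpha>) * u)"
      by (rule abs_Re_le_cmod)
    also have "\<dots> = cmod u" by (simp add: norm_mult)
    finally have "- cmod u \<le> Re (exp (- \<i> * of_real \<alpha>) * u)" by linarith
    moreover have "Re (exp (- \<i> * of_real \<alpha>) * (1 + u)) = cos \<alpha> + Re (exp (- \<i> * of_real \<alpha>) * u)"
      unfolding distrib_left plus_complex.sel by (simp add: Re_exp)
    ultimately have "Re (exp (- \<i> * of_real \<alpha>) * (1 + u)) > cmod u + \<beta>"
      using u unfolding C_def by linarith
    then show ?thesis unfolding w by (simp only: add_diff_cancel_left')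
  qed
  then show ?thesis
    using f class_A_zderiv[OF f] by (auto simp: class_UCV_def class_SP_def)
qed

section \<open>The negative binomial series and the Pascal weights\<close>

text \<open>Newton's binomial series for exponent -m at -q; the signs of the generalized binomial
  coefficient and of the power cancel.\<close>

lemma negative_binomial_sums:
  fixes m q :: real
  assumes "\<bar>q\<bar> < 1"
  shows "(\<lambda>k. pochhammer m k / fact k * q ^ k) sums (1 - q) powr (- m)"
proof -
  have "(\<lambda>k. (- m gchoose k) * (- q) ^ k) sums (1 + - q) powr (- m)"
    using assms by (intro gen_binomial_real) simp
  moreover have "(- m gchoose k) * (- q) ^ k = pochhammer m k / fact k * q ^ k" for k
    by (subst power_minus) (simp add: gbinomial_pochhammer mult.left_commute flip: mult.assoc power_mult_distrib)
  ultimately show ?thesis by simp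
qed

text \<open>For m > 0, \<open>p k\<close> is the probability of the value k + 1 under the Pascal
  distribution. The first sum is the total mass without the mass (1 - q)^m at 0, the second is the
  mean.\<close>

lemma pascal_weights_sums:
  fixes m q :: real
  assumes "0 \<le> q" "q < 1"
  defines "p \<equiv> \<lambda>k. pascal_binom m (k + 2) * q ^ (k + 1) * (1 - q) powr m"
  shows "p sums (1 - (1 - q) powr m)" and "(\<lambda>k. real (k + 1) * p k) sums (q * m / (1 - q))"
proof -
  have "(\<lambda>k. pochhammer m (k + 1) / fact (k + 1) * q ^ (k + 1)) sums ((1 - q) powr (- m) - 1)"
    using sums_split_initial_segment[OF negative_binomial_sums[of q m], of 1] assms by simp
  from sums_mult2[OF this, of "(1 - q) powr m"]
  show "p sums (1 - (1 - q) powr m)"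
    using assms(1,2) by (simp add: p_def pascal_binom_def algebra_simps flip: powr_add)
  have "(\<lambda>k. q * m * (1 - q) powr m * (pochhammer (m + 1) k / fact k * q ^ k)) sums
      (q * m * (1 - q) powr m * (1 - q) powr (- (m + 1)))"
    by (intro sums_mult negative_binomial_sums) (use assms in auto)
  \<comment> \<open>The factor k + 1 cancels in the factorial and a factor m splits off the
    Pochhammer symbol, leaving the series with parameter m + 1.\<close>
  moreover have "q * m * (1 - q) powr m * (pochhammer (m + 1) k / fact k * q ^ k) = real (k + 1) * p k" for k
    by (simp add: p_def pascal_binom_def pochhammer_rec add.commute del: of_nat_Suc)
  moreover have "(1 - q) powr m * (1 - q) powr (- (m + 1)) = 1 / (1 - q)"
    using assms(1,2) by (simp add: powr_minus_divide flip: powr_add)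
  then have "q * m * (1 - q) powr m * (1 - q) powr (- (m + 1)) = q * m / (1 - q)"
    by (simp only: mult.assoc) simp
  ultimately show "(\<lambda>k. real (k + 1) * p k) sums (q * m / (1 - q))" by (simp only:)
qed

section \<open>Power series of the image under the Pascal operator\<close>

lemma normalized_power_series:
  assumes "\<And>z. z \<in> ball 0 1 \<Longrightarrow> (\<lambda>k. c k * z ^ (k + 2)) sums (f z - z)"
  shows "f \<in> class_A" and "taylor_coeff f (k + 2) = c k"
proof -
  define b where "b n = (if n = 0 then 0 else if n = 1 then 1 else c (n - 2))" for n
  have *: "(\<lambda>n. b n * z ^ n) sums f z" if "z \<in> ball 0 1" for z
    using assms[OF that] sums_iff_shift[of "\<lambda>n. b n * z ^ n" 2 "f z - z"]
    by (simp add: b_def numeral_2_eq_2)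
  show "f \<in> class_A" by (rule class_A_if_sums[OF *]) (simp_all add: b_def)
  show "taylor_coeff f (k + 2) = c k" using taylor_coeff_eqI[OF *] by (simp add: b_def)
qed

lemma pascal_weight_nonneg:
  fixes m q :: real
  assumes "m > 0" "0 \<le> q"
  shows "pascal_binom m n * q ^ k * (1 - q) powr m \<ge> 0"
  using assms by (simp add: pascal_binom_def pochhammer_nonneg)

text \<open>The infinite sum in \<open>pascal_op\<close> carries information only once convergence
  is known. The summable series of \<open>p k * M\<close> dominates it.\<close>

lemma pascal_op_sums:
  fixes m q :: real
  assumes f: "f \<in> class_A" and "m > 0" "0 \<le> q" "q < 1" and z: "z \<in> ball 0 1"
    and bdd: "\<And>n. n \<ge> 2 \<Longrightarrow> cmod (taylor_coeff f n) \<le> M"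
  defines "p \<equiv> \<lambda>k. pascal_binom m (k + 2) * q ^ (k + 1) * (1 - q) powr m"
  shows "(\<lambda>k. of_real (p k) * taylor_coeff f (k + 2) * z ^ (k + 2)) sums (pascal_op q m f z - z)"
proof -
  have p: "p k \<ge> 0" for k
    unfolding p_def by (rule pascal_weight_nonneg) fact+
  have "cmod (of_real (p k) * taylor_coeff f (k + 2) * z ^ (k + 2)) \<le> p k * M" for k
  proof -
    have "cmod z ^ (k + 2) \<le> 1" using z by (intro power_le_one) auto
    then have "p k * (cmod (taylor_coeff f (k + 2)) * cmod z ^ (k + 2)) \<le> p k * (M * 1)"
      using bdd[of "k + 2"] order_trans[OF norm_ge_zero bdd[of "k + 2"]]
      by (intro mult_left_mono mult_mono p) auto
    then show ?thesis using p[of k] by (simp add: norm_mult norm_power mult.assoc)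
  qed
  moreover have "summable (\<lambda>k. p k * M)"
    unfolding p_def by (intro summable_mult2 sums_summable[OF pascal_weights_sums(1)]) fact+
  ultimately have "summable (\<lambda>k. of_real (p k) * taylor_coeff f (k + 2) * z ^ (k + 2))"
    by (rule summable_comparison_test'[where N = 0, rotated])
  then show ?thesis
    using summable_sums by (simp add: pascal_op_def p_def)
qed

section \<open>The Pascal operator on the class R\<close>

text \<open>At z = 0 the inequality of \<open>class_SP\<close> reads \<beta> < cos \<alpha>, while
  the numerical condition also admits equality, for instance at q = 0. Membership in
  \<open>class_UCT\<close> requires the sign pattern of \<open>class_T\<close>, which the
  nonnegative weights carry over from f.\<close>

theorem theorem3p2:
  fixes \<alpha> \<beta> m q A B :: real and \<tau> :: complex and f :: "complex \<Rightarrow> complex"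
  assumes "\<bar>\<alpha>\<bar> < pi / 2" and "0 \<le> \<beta>" and "\<beta> < 1" and "m \<ge> 1" and "0 \<le> q" and "q < 1"
    and "\<tau> \<noteq> 0" and "-1 \<le> B" and "B < A" and "A \<le> 1"
    and "\<beta> < cos \<alpha>"
    and "f \<in> class_R \<tau> A B"
    and "(A - B) * cmod \<tau> * (2 * q * m / (1 - q) + (2 - cos \<alpha> - \<beta>) * (1 - (1 - q) powr m))
           \<le> cos \<alpha> - \<beta>"
  shows "pascal_op q m f \<in> class_UCV \<alpha> \<beta> \<and>
         (f \<in> class_T \<longrightarrow> pascal_op q m f \<in> class_UCT \<alpha> \<beta>)"
proof -
  define F where "F = pascal_op q m f"
  define K where "K = (A - B) * cmod \<tau>"
  define p where "p k = pascal_binom m (k + 2) * q ^ (k + 1) * (1 - q) powr m" for k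
  define e where "e n = 2 * real (n + 2) - cos \<alpha> - \<beta>" for n
  note q = \<open>0 \<le> q\<close> \<open>q < 1\<close>
  have f: "f \<in> class_A" using assms(12) by (simp add: class_R_def)
  have p: "p k \<ge> 0" for k
    unfolding p_def by (rule pascal_weight_nonneg) (use assms in auto)
  have e: "e n \<ge> 0" for n
  proof -
    have "0 < 2 - cos \<alpha> - \<beta>" using assms(3) cos_le_one[of \<alpha>] by linarith
    moreover have "e n = 2 * real (n + 1) + (2 - cos \<alpha> - \<beta>)" by (simp add: e_def)
    ultimately show ?thesis by simp
  qed
  have coeff: "real n * cmod (taylor_coeff f n) \<le> K" if "n \<ge> 2" for n
    unfolding K_def by (rule class_R_taylor_coeff_bound) (use assms that in auto)
  have bdd: "cmod (taylor_coeff f n) \<le> K" if "n \<ge> 2" for n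
  proof -
    have "1 * cmod (taylor_coeff f n) \<le> real n * cmod (taylor_coeff f n)"
      by (rule mult_right_mono) (use that in auto)
    then show ?thesis using coeff[OF that] by linarith
  qed
  have F_sums: "(\<lambda>k. of_real (p k) * taylor_coeff f (k + 2) * z ^ (k + 2)) sums (F z - z)"
    if "z \<in> ball 0 1" for z
    unfolding p_def F_def by (rule pascal_op_sums) (use f assms(4) q that bdd in auto)
  have F_A: "F \<in> class_A"
    by (rule normalized_power_series(1)[OF F_sums])
  have F_coeff: "taylor_coeff F (k + 2) = of_real (p k) * taylor_coeff f (k + 2)" for k
    by (rule normalized_power_series(2)[OF F_sums])

  \<comment> \<open>Writing \<open>e n\<close> as 2 (n + 1) + (2 - cos \<alpha> - \<beta>) splits
    the sum into the mean and the mass of the Pascal weights.\<close>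
  have "(\<lambda>n. K * (2 * (real (n + 1) * p n) + (2 - cos \<alpha> - \<beta>) * p n)) sums
      (K * (2 * (q * m / (1 - q)) + (2 - cos \<alpha> - \<beta>) * (1 - (1 - q) powr m)))"
    unfolding p_def by (intro sums_mult sums_add pascal_weights_sums q)
  moreover have "K * (2 * (real (n + 1) * p n) + (2 - cos \<alpha> - \<beta>) * p n) = K * (e n * p n)" for n
    by (simp add: e_def algebra_simps)
  ultimately have "(\<lambda>n. K * (e n * p n)) sums
      (K * (2 * (q * m / (1 - q)) + (2 - cos \<alpha> - \<beta>) * (1 - (1 - q) powr m)))"
    by (simp only:)
  then have bound: "(\<lambda>n. K * (e n * p n)) sums
      (K * (2 * q * m / (1 - q) + (2 - cos \<alpha> - \<beta>) * (1 - (1 - q) powr m)))"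
    by (simp add: mult.assoc)
  \<comment> \<open>The factor n + 2 of the criterion is absorbed by the coefficient bound
    \<open>coeff\<close>.\<close>
  have term_le: "real (n + 2) * e n * cmod (taylor_coeff F (n + 2)) \<le> K * (e n * p n)" for n
  proof -
    have "real (n + 2) * e n * cmod (taylor_coeff F (n + 2))
        = real (n + 2) * cmod (taylor_coeff f (n + 2)) * (e n * p n)"
      unfolding F_coeff norm_mult norm_of_real abs_of_nonneg[OF p] by (simp only: mult_ac)
    also have "\<dots> \<le> K * (e n * p n)"
      by (intro mult_right_mono coeff mult_nonneg_nonneg e p) simp
    finally show ?thesis .
  qed
  have summ: "summable (\<lambda>n. real (n + 2) * e n * cmod (taylor_coeff F (n + 2)))"
  proof (rule summable_comparison_test'[OF sums_summable[OF bound], of 0])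
    fix n
    have "0 \<le> real (n + 2) * e n * cmod (taylor_coeff F (n + 2))"
      by (intro mult_nonneg_nonneg e) auto
    then show "norm (real (n + 2) * e n * cmod (taylor_coeff F (n + 2))) \<le> K * (e n * p n)"
      using term_le by (simp only: real_norm_def abs_of_nonneg)
  qed
  have "suminf (\<lambda>n. real (n + 2) * e n * cmod (taylor_coeff F (n + 2))) \<le> cos \<alpha> - \<beta>"
    using suminf_le[OF term_le summ sums_summable[OF bound]] sums_unique[OF bound] assms(13)
    unfolding K_def by linarith
  with summ have UCV: "F \<in> class_UCV \<alpha> \<beta>"
    unfolding e_def by (intro UCV_criterion F_A \<open>\<beta> < cos \<alpha>\<close>)

  have "F \<in> class_T" if T: "f \<in> class_T"
  proof -
    from T obtain a :: "nat \<Rightarrow> complex" where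
      a: "\<And>z. z \<in> ball 0 1 \<Longrightarrow> (\<lambda>n. of_real (cmod (a (n + 2))) * z ^ (n + 2)) sums (z - f z)"
      unfolding class_T_def by blast
    have "(\<lambda>n. - of_real (cmod (a (n + 2))) * z ^ (n + 2)) sums (f z - z)" if "z \<in> ball 0 1" for z
      using sums_minus[OF a[OF that]] by simp
    \<comment> \<open>The sequence \<open>a\<close> is tied to f only through its series; uniqueness
      of Taylor coefficients identifies the two.\<close>
    then have tc: "taylor_coeff f (k + 2) = - of_real (cmod (a (k + 2)))" for k
      by (rule normalized_power_series(2))
    \<comment> \<open>Nonnegative weights may be moved inside the modulus, which gives the witness
      for \<open>class_T\<close>. The shift by 2 reconciles \<open>p\<close>, indexed from 0, with
      the coefficient index.\<close>
    have "(\<lambda>n. complex_of_real (cmod (of_real (p (n + 2 - 2)) * a (n + 2))) * z ^ (n + 2)) sums (z - F z)"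
      if "z \<in> ball 0 1" for z
      using sums_minus[OF F_sums[OF that, unfolded tc]] p by (simp add: norm_mult)
    then show ?thesis
      unfolding class_T_def using F_A
      by (intro CollectI conjI exI[of _ "\<lambda>n. of_real (p (n - 2)) * a n"]) auto
  qed
  with UCV show ?thesis unfolding F_def class_UCT_def by blast
qed

end
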